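(* Let $f:\mathbb{R}^d\to\mathbb{R}$ be a differentiable function with unique minimizer $x^\star$ which is convex and $L$-smooth for some $L>0$. Let $0<\eta\le\frac{1}{\sqrt{L}}$, $K\ge1$ an integer, $x_0\in\mathbb{R}^d$, and let $N_0=4$ and positive integers $N_1,\dots,N_K$ satisfy $N_k(N_k+1)\ge\frac{3}{\sqrt3+1}N_{k-1}(N_{k-1}+1)$ for all $k\in\{1,\dots,K\}$. Let $x_K$ be the output of the algorithm dHFA-eg run from $x_0$ for $K$ iterations with parameter $\lambda=\frac{\sqrt3+1}{2}$, step size $\eta$, and discretization steps $N_1,\dots,N_K$. Then $$f(x_K)-f(x^\star)\le\left(\frac{\sqrt3+1}{3}\right)^K\left(f(x_0)-f(x^\star)+\frac{\sqrt3-1}{60\,\eta^2}\|x_0-x^\star\|^2\right).$$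
   Context: $f$ is $L$-smooth if $f(x')\le f(x)+\langle\nabla f(x),x'-x\rangle+\frac{L}{2}\|x'-x\|^2$ for all $x,x'\in\mathbb{R}^d$. The extragradient integrator with step size $\eta>0$ started at $(x_0,y_0)\in\mathbb{R}^{2d}$ generates, for $n\ge0$, $x_{n+1/2}=x_n+\eta y_n$, $x_{n+1}=x_{n+1/2}-\eta^2\nabla f(x_{n+1/2})$, $y_{n+1}=y_n-\eta\nabla f(x_{n+1})$. Algorithm dHFA-eg. Input: $x_0\in\mathbb{R}^d$, number of iterations $K\in\mathbb{N}$, parameter $\lambda\ge0$, step size $\eta>0$, discretization steps $N_1,\dots,N_K\in\mathbb{N}$ (positive integers). For $k=1,\dots,K$: generate $(x^{(k)}_n,y^{(k)}_n)_{n=1}^{N_k}$ with the extragradient integrator with step size $\eta$ started at $(x^{(k)}_0,y^{(k)}_0)=(x_{k-1},\mathbf{0})$; compute $x^{\mathrm{avg}}(x_{k-1};N_k)=\frac{2}{N_k(N_k+1)}\sum_{n=1}^{N_k}(N_k-n+1)x^{(k)}_n$; set $x_k=\frac{1}{\lambda+1}x^{\mathrm{avg}}(x_{k-1};N_k)+\frac{\lambda}{\lambda+1}x^{(k)}_{N_k}$. Output: $x_K$. *)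

theory Defs
  imports "HOL-Analysis.Analysis"
begin

text \<open>Only meaningful where \<open>f\<close> is differentiable; \<open>GDERIV f x :> D\<close> determines \<open>D\<close> uniquely.\<close>

definition grad :: "('a::real_inner \<Rightarrow> real) \<Rightarrow> 'a \<Rightarrow> 'a" where
  "grad f x = (THE D. GDERIV f x :> D)"

lemma GDERIV_unique:
  assumes "GDERIV f x :> D" "GDERIV f x :> D'"
  shows "D = D'"
proof -
  have "(\<lambda>h. inner h D) = (\<lambda>h. inner h D')"
    using assms has_derivative_unique unfolding gderiv_def by blast
  then have "inner (D - D') D = inner (D - D') D'" by metis
  then have "inner (D - D') (D - D') = 0" by (simp add: inner_diff_right)
  then show ?thesis by simp
qed

lemma grad_eqI: "GDERIV f x :> D \<Longrightarrow> grad f x = D"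
  unfolding grad_def by (blast intro: GDERIV_unique)

lemma GDERIV_grad:
  fixes f :: "'a::euclidean_space \<Rightarrow> real"
  assumes "f differentiable (at x)"
  shows "GDERIV f x :> grad f x"
proof -
  let ?F = "frechet_derivative f (at x)"
  have F: "(f has_derivative ?F) (at x)"
    using assms by (simp add: frechet_derivative_works)
  have "?F h = inner h (adjoint ?F 1)" for h
    using adjoint_works[OF has_derivative_linear[OF F], of h 1] by simp
  then have "?F = (\<lambda>h. inner h (adjoint ?F 1))" by blast
  with F have "GDERIV f x :> adjoint ?F 1"
    unfolding gderiv_def by metis
  then show ?thesis using grad_eqI by metis
qed

definition L_smooth :: "real \<Rightarrow> ('a::real_inner \<Rightarrow> real) \<Rightarrow> bool" where
  "L_smooth L f \<longleftrightarrow>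
     (\<forall>x x'. f x' \<le> f x + inner (grad f x) (x' - x) + L / 2 * (norm (x' - x))\<^sup>2)"

definition eg_step :: "('a::real_inner \<Rightarrow> real) \<Rightarrow> real \<Rightarrow> 'a \<times> 'a \<Rightarrow> 'a \<times> 'a" where
  "eg_step f \<eta> = (\<lambda>(x, y).
     let xh = x + \<eta> *\<^sub>R y;
         x' = xh - \<eta>\<^sup>2 *\<^sub>R grad f xh;
         y' = y - \<eta> *\<^sub>R grad f x'
     in (x', y'))"

definition eg :: "('a::real_inner \<Rightarrow> real) \<Rightarrow> real \<Rightarrow> 'a \<times> 'a \<Rightarrow> nat \<Rightarrow> 'a \<times> 'a" where
  "eg f \<eta> z0 n = (eg_step f \<eta> ^^ n) z0"

definition eg_avg :: "('a::real_inner \<Rightarrow> real) \<Rightarrow> real \<Rightarrow> 'a \<Rightarrow> nat \<Rightarrow> 'a" where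
  "eg_avg f \<eta> x N =
     (2 / (real N * (real N + 1))) *\<^sub>R
       (\<Sum>n=1..N. (real N - real n + 1) *\<^sub>R fst (eg f \<eta> (x, 0) n))"

text \<open>\<open>dHFA_eg f lam \<eta> N x0 k\<close> is the iterate \<open>x\<^sub>k\<close>; it uses only \<open>N 1, \<dots>, N k\<close>.\<close>

primrec dHFA_eg ::
  "('a::real_inner \<Rightarrow> real) \<Rightarrow> real \<Rightarrow> real \<Rightarrow> (nat \<Rightarrow> nat) \<Rightarrow> 'a \<Rightarrow> nat \<Rightarrow> 'a" where
  "dHFA_eg f lam \<eta> N x0 0 = x0"
| "dHFA_eg f lam \<eta> N x0 (Suc k) =
     (let x = dHFA_eg f lam \<eta> N x0 k; n = N (Suc k)
      in (1 / (lam + 1)) *\<^sub>R eg_avg f \<eta> x n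
         + (lam / (lam + 1)) *\<^sub>R fst (eg f \<eta> (x, 0) n))"

end

theory Submission
  imports Defs
begin

text \<open>
  Up to discretization the integrator follows Newton's equation \<open>x'' = - \<nabla>f(x)\<close> from rest.
  Write \<open>\<Delta>\<close> for \<open>f(x) - f(x\<^sup>*)\<close> and \<open>D\<close> for the squared distance of \<open>x\<close> to \<open>x\<^sup>*\<close>.
  Conservation of energy gives \<open>|x'|\<^sup>2 = 2 (\<Delta>(0) - \<Delta>)\<close>, and with convexity
  \<open>(D / 2)'' = |x'|\<^sup>2 - \<langle>\<nabla>f(x), x - x\<^sup>*\<rangle> \<le> 2 \<Delta>(0) - 3 \<Delta>\<close>.
  Integrating this twice up to time \<open>t\<close> puts the triangular weights of the average on \<open>\<Delta>\<close>, and yields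
  two bounds. Jensen's inequality turns the first one into
  \<open>\<Delta>(avg) \<le> 2/3 \<Delta>(0) + (D(0) - D(t)) / (3 t\<^sup>2)\<close>; dropping the \<open>\<Delta>\<close> terms and then averaging gives
  \<open>D(avg) \<le> D(0) + t\<^sup>2 \<Delta>(0) / 3\<close>.

  The extragradient discretization keeps both bounds without any loss if \<open>t\<^sup>2\<close> is replaced by
  \<open>\<eta>\<^sup>2 n (n + 1)\<close>: see \<open>gap_avg_le\<close> and \<open>sq_dist_avg_le\<close>. The energy decreases
  (\<open>energy_step\<close>) because the extrapolated gradient step makes the new gradient no longer than the
  component along it of the gradient at the midpoint (\<open>gradient_after_descent\<close>). The double
  integral becomes two inductions, for \<open>\<langle>x - x\<^sup>*, y\<rangle>\<close> in \<open>momentum_le\<close> and for \<open>D\<close> in \<open>sq_dist_le\<close>.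

  One outer iteration mixes the average with the endpoint of the trajectory. The endpoint contributes
  \<open>D(t)\<close> with a positive sign and the bound on \<open>\<Delta>(avg)\<close> contributes it with a negative sign; in the
  potential \<open>\<Delta> + c D / t\<^sup>2\<close> these cancel for \<open>c = (sqrt 3 - 1) / 3\<close> and the given \<open>\<lambda>\<close>, while
  the coefficient of \<open>D(0)\<close> remains \<open>c / t\<^sup>2\<close> (\<open>outer_step\<close>). The coefficient of \<open>\<Delta>(0)\<close> is less
  than \<open>\<rho> = (sqrt 3 + 1) / 3\<close>. Since \<open>t\<^sup>2\<close> grows by a factor of at least \<open>1 / \<rho>\<close> from one iteration
  to the next, the potential contracts by \<open>\<rho>\<close>.
\<close>

section \<open>Convexity and smoothness\<close>

lemma convex_above_gradient:
  fixes f :: "'a::real_inner \<Rightarrow> real"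
  assumes cvx: "convex_on UNIV f" and D: "GDERIV f x :> D"
  shows "f x + inner D (y - x) \<le> f y"
proof -
  \<comment> \<open>Restricting to the line through \<open>x\<close> and \<open>y\<close> reduces this to one real variable.\<close>
  define \<phi> where "\<phi> t = f (x + t *\<^sub>R (y - x))" for t :: real
  have "convex_on UNIV \<phi>"
  proof (rule convex_onI)
    fix t a b :: real
    assume t: "0 < t" "t < 1"
    have "x + ((1 - t) *\<^sub>R a + t *\<^sub>R b) *\<^sub>R (y - x)
        = (1 - t) *\<^sub>R (x + a *\<^sub>R (y - x)) + t *\<^sub>R (x + b *\<^sub>R (y - x))"
      by (simp add: algebra_simps)
    then show "\<phi> ((1 - t) *\<^sub>R a + t *\<^sub>R b) \<le> (1 - t) * \<phi> a + t * \<phi> b"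
      unfolding \<phi>_def using convex_onD[OF cvx, of t] t by simp
  qed simp
  moreover have "(\<phi> has_real_derivative inner D (y - x)) (at 0 within UNIV)"
  proof -
    have line: "((\<lambda>t. x + t *\<^sub>R (y - x)) has_derivative (\<lambda>t. t *\<^sub>R (y - x))) (at (0::real))"
      by (auto intro!: derivative_eq_intros)
    have "(f has_derivative (\<lambda>h. inner h D)) (at (x + 0 *\<^sub>R (y - x)))"
      using D by (simp add: gderiv_def)
    from has_derivative_compose[OF line this]
    have "(\<phi> has_derivative (\<lambda>t. inner D (y - x) * t)) (at 0)"
      unfolding \<phi>_def by (simp add: inner_commute mult.commute)
    then show ?thesis by (simp add: has_field_derivative_def)
  qed
  ultimately have "inner D (y - x) * (1 - 0) \<le> \<phi> 1 - \<phi> 0"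
    by (intro convex_on_imp_above_tangent[where A = UNIV]) auto
  then show ?thesis by (simp add: \<phi>_def)
qed

lemma L_smooth_mono:
  fixes f :: "'a::real_inner \<Rightarrow> real"
  assumes "L_smooth L f" "L \<le> M"
  shows "L_smooth M f"
  unfolding L_smooth_def
proof (intro allI)
  fix x x' :: 'a
  have "L / 2 * (norm (x' - x))\<^sup>2 \<le> M / 2 * (norm (x' - x))\<^sup>2"
    using assms(2) by (intro mult_right_mono) auto
  with assms(1) show "f x' \<le> f x + inner (grad f x) (x' - x) + M / 2 * (norm (x' - x))\<^sup>2"
    unfolding L_smooth_def by (smt (verit))
qed

lemma convex_on_sq_dist:
  fixes p :: "'a::real_inner"
  shows "convex_on UNIV (\<lambda>x. (norm (x - p))\<^sup>2)"
proof (rule convex_onI)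
  fix t :: real and x y :: 'a
  assume t: "0 < t" "t < 1"
  have "(1 - t) * (norm (x - p))\<^sup>2 + t * (norm (y - p))\<^sup>2
      - (norm ((1 - t) *\<^sub>R x + t *\<^sub>R y - p))\<^sup>2 = t * (1 - t) * (norm (x - y))\<^sup>2"
    unfolding power2_norm_eq_inner
    by (simp add: inner_simps inner_commute algebra_simps power2_eq_square)
  moreover have "0 \<le> t * (1 - t) * (norm (x - y))\<^sup>2" using t by simp
  ultimately show "(norm ((1 - t) *\<^sub>R x + t *\<^sub>R y - p))\<^sup>2
      \<le> (1 - t) * (norm (x - p))\<^sup>2 + t * (norm (y - p))\<^sup>2" by linarith
qed simp

section \<open>Triangular averages\<close>

text \<open>Raising the length by one raises every triangular weight by one, so triangular sums are
  partial sums of partial sums: the discrete form of integrating twice.\<close>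

lemma weighted_sum_Suc:
  fixes a :: "nat \<Rightarrow> real"
  shows "(\<Sum>m=1..Suc n. (real (Suc n) - real m + 1) * a m)
    = (\<Sum>m=1..n. (real n - real m + 1) * a m) + (\<Sum>m=1..Suc n. a m)"
proof -
  have "(\<Sum>m=1..n. (real (Suc n) - real m + 1) * a m)
      = (\<Sum>m=1..n. (real n - real m + 1) * a m) + (\<Sum>m=1..n. a m)"
    by (simp add: sum.distrib[symmetric] algebra_simps)
  then show ?thesis by simp
qed

lemma sum_triangle_weights: "(\<Sum>m=1..n. real n - real m + 1) = real n * (real n + 1) / 2"
proof (induction n)
  case (Suc n)
  have "(\<Sum>m=1..Suc n. real (Suc n) - real m + 1)
      = (\<Sum>m=1..n. real n - real m + 1) + (real n + 1)"
    using weighted_sum_Suc[of n "\<lambda>_. 1"] by simp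
  with Suc show ?case by (simp add: field_simps)
qed simp

lemma sum_falling_square: "(\<Sum>m=1..n. real m * (real m - 1)) = (real n - 1) * real n * (real n + 1) / 3"
  by (induction n) (simp_all add: field_simps)

text \<open>The triangular mean of \<open>m (m - 1)\<close> is \<open>(n - 1) (n + 2) / 6\<close>, and therefore below
  \<open>n (n + 1) / 6\<close>. It measures how far the averaged iterate can drift from the minimizer.\<close>

lemma sum_triangle_weights_square:
  "(\<Sum>m=1..n. (real n - real m + 1) * (real m * (real m - 1)))
    = (real n - 1) * real n * (real n + 1) * (real n + 2) / 12"
proof (induction n)
  case (Suc n)
  show ?case
    unfolding weighted_sum_Suc Suc sum_falling_square by (simp add: field_simps)
qed simp

lemma convex_eg_avg_le:
  fixes \<phi> :: "'a::real_inner \<Rightarrow> real"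
  assumes "convex_on UNIV \<phi>" "n > 0"
  shows "\<phi> (eg_avg f \<eta> z n)
    \<le> 2 / (real n * (real n + 1)) * (\<Sum>m=1..n. (real n - real m + 1) * \<phi> (fst (eg f \<eta> (z, 0) m)))"
proof -
  define c where "c = 2 / (real n * (real n + 1))"
  have "\<phi> (\<Sum>m\<in>{1..n}. (c * (real n - real m + 1)) *\<^sub>R fst (eg f \<eta> (z, 0) m))
      \<le> (\<Sum>m\<in>{1..n}. (c * (real n - real m + 1)) * \<phi> (fst (eg f \<eta> (z, 0) m)))"
  proof (rule convex_on_sum[OF _ _ assms(1)])
    show "(\<Sum>m=1..n. c * (real n - real m + 1)) = 1"
      unfolding sum_distrib_left[symmetric] sum_triangle_weights
      using assms(2) by (simp add: c_def)
  qed (use assms(2) in \<open>auto simp: c_def\<close>)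
  then show ?thesis
    by (simp add: eg_avg_def c_def[symmetric] scaleR_sum_right sum_distrib_left mult.assoc)
qed

section \<open>Gradients of smooth convex functions\<close>

text \<open>The step size enters as the smoothness constant \<open>1 / \<eta>\<^sup>2\<close>: a function that is \<open>L\<close>-smooth
  with \<open>\<eta> \<le> 1 / sqrt L\<close> is also \<open>1 / \<eta>\<^sup>2\<close>-smooth, and the gradient step inside the
  integrator then has the reciprocal of the smoothness constant as its step size.\<close>

locale smooth_convex_min =
  fixes f :: "'a::real_inner \<Rightarrow> real" and \<eta> :: real and p :: 'a
  assumes step_pos: "0 < \<eta>"
    and convex: "convex_on UNIV f"
    and differentiable: "GDERIV f x :> grad f x"
    and smooth: "L_smooth (1 / \<eta>\<^sup>2) f"
    and minimum: "f p \<le> f x"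
begin

abbreviation gap :: "'a \<Rightarrow> real" where "gap u \<equiv> f u - f p"

lemma upper_quadratic:
  "f (u - \<eta>\<^sup>2 *\<^sub>R w) \<le> f u - \<eta>\<^sup>2 * inner (grad f u) w + \<eta>\<^sup>2 / 2 * (norm w)\<^sup>2"
proof -
  have "f (u - \<eta>\<^sup>2 *\<^sub>R w) \<le> f u + inner (grad f u) ((u - \<eta>\<^sup>2 *\<^sub>R w) - u)
      + 1 / \<eta>\<^sup>2 / 2 * (norm ((u - \<eta>\<^sup>2 *\<^sub>R w) - u))\<^sup>2"
    using smooth unfolding L_smooth_def by blast
  also have "\<dots> = f u - \<eta>\<^sup>2 * inner (grad f u) w + \<eta>\<^sup>2 / 2 * (norm w)\<^sup>2"
    using step_pos by (simp add: power_mult_distrib power2_eq_square)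
  finally show ?thesis .
qed

text \<open>Besides the two points, a third one is tested: the gradient step
  \<open>v - \<eta>\<^sup>2 (\<nabla>f(v) - \<nabla>f(u))\<close> for the convex function \<open>x \<mapsto> f(x) - \<langle>\<nabla>f(u), x\<rangle>\<close>, which is
  minimal at \<open>u\<close>. The value of \<open>f\<close> there is bounded from below by convexity at \<open>u\<close> and from above by
  smoothness at \<open>v\<close>.\<close>

lemma strong_gradient_inequality:
  "f u + inner (grad f u) (v - u) + \<eta>\<^sup>2 / 2 * (norm (grad f v - grad f u))\<^sup>2 \<le> f v"
proof -
  define w where "w = grad f v - grad f u"
  have "f u + inner (grad f u) (v - \<eta>\<^sup>2 *\<^sub>R w - u) \<le> f (v - \<eta>\<^sup>2 *\<^sub>R w)"
    by (rule convex_above_gradient[OF convex differentiable])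
  moreover have "inner (grad f u) (v - \<eta>\<^sup>2 *\<^sub>R w - u)
      = inner (grad f u) (v - u) - \<eta>\<^sup>2 * inner (grad f u) w"
    by (simp add: inner_diff_right)
  moreover have "\<eta>\<^sup>2 * inner (grad f v) w = \<eta>\<^sup>2 * inner (grad f u) w + \<eta>\<^sup>2 * (norm w)\<^sup>2"
    unfolding power2_norm_eq_inner by (simp add: w_def inner_diff_left algebra_simps)
  ultimately show ?thesis
    using upper_quadratic[of v w] unfolding w_def[symmetric] by linarith
qed

lemma gradient_descent: "f (u - \<eta>\<^sup>2 *\<^sub>R grad f u) \<le> f u - \<eta>\<^sup>2 / 2 * (norm (grad f u))\<^sup>2"
  using upper_quadratic[of u "grad f u"] by (simp add: power2_norm_eq_inner)

lemma grad_minimum: "grad f p = 0"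
proof -
  have "\<eta>\<^sup>2 / 2 * (norm (grad f p))\<^sup>2 \<le> 0"
    using gradient_descent[of p] minimum[of "p - \<eta>\<^sup>2 *\<^sub>R grad f p"] by linarith
  with step_pos show ?thesis
    by (simp add: mult_le_0_iff)
qed

lemma gradient_towards_minimum:
  "gap u + \<eta>\<^sup>2 / 2 * (norm (grad f u))\<^sup>2 \<le> inner (grad f u) (u - p)"
  using strong_gradient_inequality[of u p] grad_minimum by (simp add: inner_diff_right)

text \<open>Adding the strong gradient inequality in both directions shows that the gradient
  is co-coercive with constant \<open>\<eta>\<^sup>2\<close>. For two points that differ by \<open>\<eta>\<^sup>2\<close> times the gradient \<open>h\<close> at
  the first one, co-coercivity reads \<open>|g - h|\<^sup>2 \<le> \<langle>h - g, h\<rangle>\<close>, which is the claim.\<close>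

lemma gradient_after_descent:
  defines "g \<equiv> \<lambda>u. grad f (u - \<eta>\<^sup>2 *\<^sub>R grad f u)"
  shows "(norm (g u))\<^sup>2 \<le> inner (g u) (grad f u)"
proof -
  define v where "v = u - \<eta>\<^sup>2 *\<^sub>R grad f u"
  define h where "h = grad f u"
  have "inner h (v - u) + inner (grad f v) (u - v) + \<eta>\<^sup>2 * (norm (grad f v - h))\<^sup>2 \<le> 0"
    using strong_gradient_inequality[of u v] strong_gradient_inequality[of v u]
    by (simp add: h_def norm_minus_commute[of "grad f u"])
  then have "\<eta>\<^sup>2 * ((norm (grad f v))\<^sup>2 - inner (grad f v) h) \<le> 0"
    unfolding power2_norm_eq_inner
    by (simp add: v_def h_def[symmetric] inner_simps inner_commute algebra_simps)
  then have "(norm (grad f v))\<^sup>2 - inner (grad f v) h \<le> 0"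
    using step_pos by (simp add: mult_le_0_iff)
  then show ?thesis by (simp add: g_def v_def h_def)
qed

section \<open>One run of the integrator from rest\<close>

context
  fixes z :: 'a
begin

abbreviation "pos n \<equiv> fst (eg f \<eta> (z, 0) n)"
abbreviation "vel n \<equiv> snd (eg f \<eta> (z, 0) n)"
abbreviation "mid n \<equiv> pos n + \<eta> *\<^sub>R vel n"

lemma eg_start: "pos 0 = z" "vel 0 = 0"
  by (simp_all add: eg_def)

lemma eg_Suc:
  "pos (Suc n) = mid n - \<eta>\<^sup>2 *\<^sub>R grad f (mid n)"
  "vel (Suc n) = vel n - \<eta> *\<^sub>R grad f (pos (Suc n))"
  by (simp_all add: eg_def eg_step_def Let_def case_prod_beta)

lemma gap_mid: "gap (pos (Suc n)) + \<eta>\<^sup>2 / 2 * (norm (grad f (mid n)))\<^sup>2 \<le> gap (mid n)"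
  unfolding eg_Suc(1) using gradient_descent[of "mid n"] by simp

text \<open>With \<open>g\<close> the gradient at the new position and \<open>h\<close> the one at the midpoint, convexity
  bounds the change of potential energy by \<open>\<eta> \<langle>g, y\<rangle> - \<eta>\<^sup>2 \<langle>g, h\<rangle>\<close>, while the kinetic energy
  changes by \<open>- \<eta> \<langle>g, y\<rangle> + \<eta>\<^sup>2 |g|\<^sup>2 / 2\<close>. The term \<open>\<eta>\<^sup>2 \<langle>g, h\<rangle>\<close>, which comes from the
  extrapolation, absorbs the discretization error \<open>\<eta>\<^sup>2 |g|\<^sup>2 / 2\<close>.\<close>

lemma energy_step:
  "gap (pos (Suc n)) + (norm (vel (Suc n)))\<^sup>2 / 2 \<le> gap (pos n) + (norm (vel n))\<^sup>2 / 2"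
proof -
  define g where "g = grad f (pos (Suc n))"
  define h where "h = grad f (mid n)"
  define y where "y = vel n"
  have "pos n - pos (Suc n) = \<eta>\<^sup>2 *\<^sub>R h - \<eta> *\<^sub>R y"
    by (simp add: eg_Suc(1) h_def y_def)
  then have "f (pos (Suc n)) + \<eta>\<^sup>2 * inner g h - \<eta> * inner g y \<le> f (pos n)"
    using convex_above_gradient[OF convex differentiable, of "pos (Suc n)" "pos n"]
    by (simp add: g_def[symmetric] inner_diff_right)
  moreover have "\<eta>\<^sup>2 * (norm g)\<^sup>2 \<le> \<eta>\<^sup>2 * inner g h"
    using gradient_after_descent[of "mid n"]
    by (intro mult_left_mono) (simp_all add: g_def h_def eg_Suc(1))
  moreover have "(norm (vel (Suc n)))\<^sup>2
      = (norm y)\<^sup>2 - 2 * (\<eta> * inner g y) + \<eta>\<^sup>2 * (norm g)\<^sup>2"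
    unfolding eg_Suc(2) g_def[symmetric] y_def[symmetric] power2_norm_eq_inner
    by (simp add: inner_simps inner_commute power2_eq_square algebra_simps)
  moreover have "0 \<le> \<eta>\<^sup>2 * (norm g)\<^sup>2" by simp
  ultimately show ?thesis unfolding y_def by linarith
qed

lemma energy_le: "gap (pos n) + (norm (vel n))\<^sup>2 / 2 \<le> gap z"
proof (induction n)
  case 0
  show ?case by (simp add: eg_start)
next
  case (Suc n)
  then show ?case using energy_step[of n] by linarith
qed

lemma gap_pos_le: "gap (pos n) \<le> gap z"
  using energy_le[of n] zero_le_power2[of "norm (vel n)"] by linarith

text \<open>The discrete counterpart of \<open>(D / 2)'' \<le> 2 \<Delta>(0) - 3 \<Delta>\<close>. The extrapolation adds the
  term \<open>- \<eta> \<langle>h, \<eta> y\<rangle>\<close>; convexity at the midpoint and the descent from there to the new position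
  bound it by a difference of consecutive gaps, so it shifts only the index at which \<open>\<Delta>\<close> is
  evaluated.\<close>

lemma momentum_step:
  "inner (pos (Suc n) - p) (vel (Suc n))
    \<le> inner (pos n - p) (vel n) + \<eta> * (2 * gap z - gap (pos n) - 2 * gap (pos (Suc n)))"
proof -
  define g where "g = grad f (pos (Suc n))"
  define h where "h = grad f (mid n)"
  define y where "y = vel n"
  have identity: "inner (pos (Suc n) - p) (vel (Suc n)) = inner (pos n - p) y
      + \<eta> * ((norm y)\<^sup>2 - inner h (\<eta> *\<^sub>R y) - inner g (pos (Suc n) - p))"
  proof -
    have "inner (pos (Suc n) - p) (vel (Suc n))
        = inner (pos (Suc n) - p) y - \<eta> * inner g (pos (Suc n) - p)"
      unfolding eg_Suc(2) g_def[symmetric] y_def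
      by (simp add: inner_diff_left inner_diff_right inner_commute right_diff_distrib)
    moreover have "pos (Suc n) - p = (pos n - p) + \<eta> *\<^sub>R y - \<eta>\<^sup>2 *\<^sub>R h"
      by (simp add: eg_Suc(1) h_def y_def)
    then have "inner (pos (Suc n) - p) y
        = inner (pos n - p) y + \<eta> * (norm y)\<^sup>2 - \<eta>\<^sup>2 * inner h y"
      unfolding power2_norm_eq_inner
      by (metis inner_add_left inner_diff_left inner_scaleR_left)
    ultimately show ?thesis by (simp add: algebra_simps power2_eq_square)
  qed
  have "gap (pos (Suc n)) \<le> inner g (pos (Suc n) - p)"
    using gradient_towards_minimum[of "pos (Suc n)"]
      zero_le_power2[of "\<eta> * norm (grad f (pos (Suc n)))"]
    unfolding g_def power_mult_distrib by linarith
  moreover have "f (mid n) \<le> f (pos n) + inner h (\<eta> *\<^sub>R y)"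
    using convex_above_gradient[OF convex differentiable, of "mid n" "pos n"]
    by (simp add: h_def y_def)
  moreover have "gap (pos (Suc n)) \<le> gap (mid n)"
    using gap_mid[of n] zero_le_power2[of "\<eta> * norm (grad f (mid n))"]
    unfolding power_mult_distrib by linarith
  moreover have "gap (pos n) + (norm y)\<^sup>2 / 2 \<le> gap z"
    using energy_le[of n] by (simp add: y_def)
  ultimately have "(norm y)\<^sup>2 - inner h (\<eta> *\<^sub>R y) - inner g (pos (Suc n) - p)
      \<le> 2 * gap z - gap (pos n) - 2 * gap (pos (Suc n))" by argo
  with step_pos show ?thesis unfolding identity y_def by simp
qed

lemma momentum_le:
  "inner (pos n - p) (vel n)
    \<le> \<eta> * ((2 * real n - 1) * gap z + gap (pos n) - 3 * (\<Sum>m=1..n. gap (pos m)))"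
proof (induction n)
  case 0
  show ?case by (simp add: eg_start)
next
  case (Suc n)
  have "\<eta> * ((2 * real n - 1) * gap z + gap (pos n) - 3 * (\<Sum>m=1..n. gap (pos m)))
      + \<eta> * (2 * gap z - gap (pos n) - 2 * gap (pos (Suc n)))
    = \<eta> * ((2 * real (Suc n) - 1) * gap z + gap (pos (Suc n))
      - 3 * (\<Sum>m=1..Suc n. gap (pos m)))"
    by (simp add: algebra_simps)
  with Suc momentum_step[of n] show ?case by linarith
qed

text \<open>The move to the midpoint contributes the momentum and kinetic terms. The gradient step from
  the midpoint brings the iterate closer in squared distance by \<open>2 \<eta>\<^sup>2\<close> times \<open>\<Delta>\<close> at the new position.
  When momentum and kinetic energy are bounded, \<open>\<Delta>\<close> at the old position cancels.\<close>

lemma sq_dist_step: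
  "(norm (pos (Suc n) - p))\<^sup>2 \<le> (norm (pos n - p))\<^sup>2
    + 2 * \<eta>\<^sup>2 * (2 * real n * gap z - 3 * (\<Sum>m=1..n. gap (pos m)) - gap (pos (Suc n)))"
proof -
  define h where "h = grad f (mid n)"
  have "(norm (pos (Suc n) - p))\<^sup>2
      = (norm (mid n - p))\<^sup>2 - 2 * \<eta>\<^sup>2 * inner h (mid n - p) + \<eta>\<^sup>2 * \<eta>\<^sup>2 * (norm h)\<^sup>2"
    unfolding eg_Suc(1) power2_norm_eq_inner h_def[symmetric]
    by (simp add: inner_simps inner_commute algebra_simps)
  moreover have "2 * \<eta>\<^sup>2 * (gap (pos (Suc n)) + \<eta>\<^sup>2 * (norm h)\<^sup>2)
      \<le> 2 * \<eta>\<^sup>2 * inner h (mid n - p)"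
    using gradient_towards_minimum[of "mid n"] gap_mid[of n]
    by (intro mult_left_mono) (simp_all add: h_def)
  moreover have "0 \<le> \<eta>\<^sup>2 * \<eta>\<^sup>2 * (norm h)\<^sup>2" by simp
  moreover have "(norm (mid n - p))\<^sup>2
      = (norm (pos n - p))\<^sup>2 + 2 * \<eta> * inner (pos n - p) (vel n) + \<eta>\<^sup>2 * (norm (vel n))\<^sup>2"
    unfolding power2_norm_eq_inner
    by (simp add: inner_simps inner_commute algebra_simps power2_eq_square)
  moreover have "2 * \<eta> * inner (pos n - p) (vel n) \<le> 2 * \<eta>
      * (\<eta> * ((2 * real n - 1) * gap z + gap (pos n) - 3 * (\<Sum>m=1..n. gap (pos m))))"
    using momentum_le step_pos by (intro mult_left_mono) auto
  moreover have "\<eta>\<^sup>2 * (norm (vel n))\<^sup>2 \<le> \<eta>\<^sup>2 * (2 * (gap z - gap (pos n)))"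
    using energy_le[of n] by (intro mult_left_mono) auto
  moreover have "2 * \<eta>\<^sup>2 * (gap (pos (Suc n)) + \<eta>\<^sup>2 * (norm h)\<^sup>2)
      = 2 * \<eta>\<^sup>2 * gap (pos (Suc n)) + 2 * (\<eta>\<^sup>2 * \<eta>\<^sup>2 * (norm h)\<^sup>2)"
    by (simp add: distrib_left)
  ultimately have "(norm (pos (Suc n) - p))\<^sup>2 \<le> (norm (pos n - p))\<^sup>2
      + 2 * \<eta> * (\<eta> * ((2 * real n - 1) * gap z + gap (pos n) - 3 * (\<Sum>m=1..n. gap (pos m))))
      + \<eta>\<^sup>2 * (2 * (gap z - gap (pos n))) - 2 * \<eta>\<^sup>2 * gap (pos (Suc n))"
    by linarith
  also have "\<dots> = (norm (pos n - p))\<^sup>2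
      + 2 * \<eta>\<^sup>2 * (2 * real n * gap z - 3 * (\<Sum>m=1..n. gap (pos m)) - gap (pos (Suc n)))"
    by (simp add: algebra_simps power2_eq_square)
  finally show ?thesis .
qed

text \<open>This is the twice integrated estimate with the errors of the rectangle rule: \<open>n (n - 1)\<close>
  instead of the squared time, and the surplus \<open>2 \<Sum> \<Delta>\<close>. Neither of them is estimated yet, because
  the two consequences below use the surplus differently.\<close>

lemma sq_dist_le:
  "(norm (pos n - p))\<^sup>2 \<le> (norm (z - p))\<^sup>2 + 2 * \<eta>\<^sup>2 * (real n * (real n - 1) * gap z
    - 3 * (\<Sum>m=1..n. (real n - real m + 1) * gap (pos m)) + 2 * (\<Sum>m=1..n. gap (pos m)))"
proof (induction n)
  case 0
  show ?case by (simp add: eg_start)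
next
  case (Suc n)
  let ?S = "\<lambda>n. \<Sum>m=1..n. gap (pos m)"
  let ?W = "\<lambda>n. \<Sum>m=1..n. (real n - real m + 1) * gap (pos m)"
  have "real n * (real n - 1) * gap z - 3 * ?W n + 2 * ?S n
      + (2 * real n * gap z - 3 * ?S n - gap (pos (Suc n)))
    = real (Suc n) * (real (Suc n) - 1) * gap z - 3 * ?W (Suc n) + 2 * ?S (Suc n)"
    unfolding weighted_sum_Suc by (simp add: algebra_simps)
  then have "2 * \<eta>\<^sup>2 * (real n * (real n - 1) * gap z - 3 * ?W n + 2 * ?S n)
      + 2 * \<eta>\<^sup>2 * (2 * real n * gap z - 3 * ?S n - gap (pos (Suc n)))
    = 2 * \<eta>\<^sup>2 * (real (Suc n) * (real (Suc n) - 1) * gap z - 3 * ?W (Suc n) + 2 * ?S (Suc n))"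
    by (simp only: distrib_left[symmetric])
  with Suc sq_dist_step[of n] show ?case by linarith
qed

text \<open>The surplus \<open>2 \<Sum> \<Delta>\<close> over the continuous estimate is at most \<open>2 n \<Delta>(0)\<close>, and
  \<open>n (n - 1) + 2 n = n (n + 1)\<close>.\<close>

lemma weighted_gap_le:
  "6 * \<eta>\<^sup>2 * (\<Sum>m=1..n. (real n - real m + 1) * gap (pos m))
    \<le> 2 * \<eta>\<^sup>2 * (real n * (real n + 1)) * gap z + (norm (z - p))\<^sup>2 - (norm (pos n - p))\<^sup>2"
proof -
  have "(\<Sum>m=1..n. gap (pos m)) \<le> real n * gap z"
    using sum_bounded_above[of "{1..n}" "\<lambda>m. gap (pos m)" "gap z"] gap_pos_le by simp
  then have "2 * \<eta>\<^sup>2 * (2 * (\<Sum>m=1..n. gap (pos m))) \<le> 2 * \<eta>\<^sup>2 * (2 * (real n * gap z))"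
    by (intro mult_left_mono) auto
  with sq_dist_le[of n] show ?thesis by (simp add: algebra_simps)
qed

text \<open>Every triangular weight is at least one, so three times the triangular sum dominates the
  surplus \<open>2 \<Sum> \<Delta>\<close>.\<close>

lemma sq_dist_growth:
  "(norm (pos n - p))\<^sup>2 \<le> (norm (z - p))\<^sup>2 + 2 * \<eta>\<^sup>2 * (real n * (real n - 1)) * gap z"
proof -
  have "(\<Sum>m=1..n. gap (pos m)) \<le> (\<Sum>m=1..n. (real n - real m + 1) * gap (pos m))"
  proof (rule sum_mono)
    fix m assume "m \<in> {1..n}"
    then have "1 * gap (pos m) \<le> (real n - real m + 1) * gap (pos m)"
      using minimum by (intro mult_right_mono) auto
    then show "gap (pos m) \<le> (real n - real m + 1) * gap (pos m)" by simp
  qed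
  moreover have "0 \<le> (\<Sum>m=1..n. gap (pos m))"
    using minimum by (intro sum_nonneg) simp
  ultimately have "2 * \<eta>\<^sup>2 * (real n * (real n - 1) * gap z
      - 3 * (\<Sum>m=1..n. (real n - real m + 1) * gap (pos m)) + 2 * (\<Sum>m=1..n. gap (pos m)))
    \<le> 2 * \<eta>\<^sup>2 * (real n * (real n - 1) * gap z)"
    by (intro mult_left_mono) auto
  with sq_dist_le[of n] show ?thesis by (simp add: mult.assoc)
qed

text \<open>Averaging alone reduces the gap by a factor \<open>2/3\<close>, up to the distance terms. The negative
  final distance is kept because it pays for the distance of the endpoint in the outer iteration.\<close>

lemma gap_avg_le:
  assumes "n > 0"
  shows "gap (eg_avg f \<eta> z n) \<le> 2 / 3 * gap z
    + ((norm (z - p))\<^sup>2 - (norm (pos n - p))\<^sup>2) / (3 * (\<eta>\<^sup>2 * (real n * (real n + 1))))"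
proof -
  define T where "T = real n * (real n + 1)"
  define W where "W = (\<Sum>m=1..n. (real n - real m + 1) * gap (pos m))"
  have T: "T > 0" using assms by (simp add: T_def)
  have "convex_on UNIV gap"
    using convex_on_add[OF convex, of "\<lambda>_. - f p"] by (simp add: convex_on_const)
  from convex_eg_avg_le[OF this assms] have "gap (eg_avg f \<eta> z n) \<le> 2 / T * W"
    by (simp add: T_def W_def)
  also have "\<dots> = (6 * \<eta>\<^sup>2 * W) / (3 * (\<eta>\<^sup>2 * T))"
    using step_pos T by (simp add: field_simps)
  also have "\<dots> \<le> (2 * \<eta>\<^sup>2 * T * gap z + (norm (z - p))\<^sup>2 - (norm (pos n - p))\<^sup>2) / (3 * (\<eta>\<^sup>2 * T))"
    using weighted_gap_le[of n] step_pos T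
    by (intro divide_right_mono) (simp_all add: T_def W_def)
  also have "\<dots> = 2 / 3 * gap z + ((norm (z - p))\<^sup>2 - (norm (pos n - p))\<^sup>2) / (3 * (\<eta>\<^sup>2 * T))"
    using step_pos T by (simp add: field_simps)
  finally show ?thesis unfolding T_def .
qed

lemma sq_dist_avg_le:
  assumes "n > 0"
  shows "(norm (eg_avg f \<eta> z n - p))\<^sup>2
    \<le> (norm (z - p))\<^sup>2 + \<eta>\<^sup>2 * (real n * (real n + 1)) / 3 * gap z"
proof -
  define T where "T = real n * (real n + 1)"
  define D where "D = (norm (z - p))\<^sup>2"
  have T: "T > 0" using assms by (simp add: T_def)
  have "(norm (eg_avg f \<eta> z n - p))\<^sup>2
      \<le> 2 / T * (\<Sum>m=1..n. (real n - real m + 1) * (norm (pos m - p))\<^sup>2)"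
    unfolding T_def by (rule convex_eg_avg_le[OF convex_on_sq_dist assms])
  also have "\<dots> \<le> 2 / T * (\<Sum>m=1..n. (real n - real m + 1)
      * (D + 2 * \<eta>\<^sup>2 * (real m * (real m - 1)) * gap z))"
    using T sq_dist_growth unfolding D_def
    by (intro mult_left_mono sum_mono) (auto simp: mult.assoc)
  also have "(\<Sum>m=1..n. (real n - real m + 1) * (D + 2 * \<eta>\<^sup>2 * (real m * (real m - 1)) * gap z))
      = D * (\<Sum>m=1..n. real n - real m + 1)
        + 2 * \<eta>\<^sup>2 * gap z * (\<Sum>m=1..n. (real n - real m + 1) * (real m * (real m - 1)))"
  proof -
    have "(\<Sum>m=1..n. (real n - real m + 1) * (D + 2 * \<eta>\<^sup>2 * (real m * (real m - 1)) * gap z))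
        = (\<Sum>m=1..n. D * (real n - real m + 1)
          + 2 * \<eta>\<^sup>2 * gap z * ((real n - real m + 1) * (real m * (real m - 1))))"
      by (rule sum.cong) (simp_all add: algebra_simps)
    then show ?thesis
      unfolding sum_distrib_left sum.distrib[symmetric] .
  qed
  also have "2 / T * (D * (\<Sum>m=1..n. real n - real m + 1)
        + 2 * \<eta>\<^sup>2 * gap z * (\<Sum>m=1..n. (real n - real m + 1) * (real m * (real m - 1))))
      = D + \<eta>\<^sup>2 * gap z * ((T - 2) / 3)"
  proof -
    have squares: "(\<Sum>m=1..n. (real n - real m + 1) * (real m * (real m - 1))) = T * (T - 2) / 12"
      unfolding sum_triangle_weights_square by (simp add: T_def algebra_simps)
    have total: "(\<Sum>m=1..n. real n - real m + 1) = T / 2"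
      unfolding sum_triangle_weights T_def ..
    show ?thesis unfolding squares total using T by (simp add: field_simps)
  qed
  also have "\<dots> \<le> D + \<eta>\<^sup>2 * gap z * (T / 3)"
    using minimum[of z] by (intro add_left_mono mult_left_mono) auto
  finally show ?thesis unfolding D_def T_def by (simp add: mult_ac)
qed

section \<open>Contraction over one outer iteration\<close>

text \<open>The weights of average and endpoint are \<open>1 - 1 / sqrt 3\<close> and \<open>1 / sqrt 3\<close>. Together with
  \<open>c = (sqrt 3 - 1) / 3\<close> they solve the two equations that make the final distance cancel and
  preserve the coefficient \<open>c / T\<close> of the initial distance.\<close>

lemma outer_step:
  fixes n :: nat
  defines "T \<equiv> \<eta>\<^sup>2 * (real n * (real n + 1))"
  defines "lam \<equiv> (sqrt 3 + 1) / 2"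
  defines "u \<equiv> (1 / (lam + 1)) *\<^sub>R eg_avg f \<eta> z n + (lam / (lam + 1)) *\<^sub>R pos n"
  assumes "n > 0"
  shows "gap u + (sqrt 3 - 1) / 3 / T * (norm (u - p))\<^sup>2
    \<le> (sqrt 3 + 1) / 3 * gap z + (sqrt 3 - 1) / 3 / T * (norm (z - p))\<^sup>2"
proof -
  define s where "s = sqrt (3::real)"
  define b where "b = s / 3"
  define c where "c = (s - 1) / 3 / T"
  define A D E where "A = (norm (eg_avg f \<eta> z n - p))\<^sup>2"
    and "D = (norm (z - p))\<^sup>2" and "E = (norm (pos n - p))\<^sup>2"
  have s2: "s * s = 3" by (simp add: s_def)
  have s1: "3 / 2 < s" "s < 2"
    unfolding s_def by (rule real_less_rsqrt real_less_lsqrt; simp add: power2_eq_square)+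
  have T: "T > 0" using assms step_pos by simp
  have b: "0 \<le> b" "b \<le> 1" "0 \<le> 1 - b" using s1 by (simp_all add: b_def)
  have c: "0 \<le> c" using s1 T by (simp add: c_def)
  have weights: "lam / (lam + 1) = b" "1 / (lam + 1) = 1 - b"
  proof -
    have "(s + 1) / (s + 3) = b" "2 / (s + 3) = 1 - b"
      using s1 s2 by (simp_all add: b_def field_simps)
    moreover have "lam / (lam + 1) = (s + 1) / (s + 3)" "1 / (lam + 1) = 2 / (s + 3)"
      unfolding lam_def s_def[symmetric] using s1 by (simp_all add: divide_simps) algebra
    ultimately show "lam / (lam + 1) = b" "1 / (lam + 1) = 1 - b" by simp_all
  qed
  have u: "u = (1 - b) *\<^sub>R eg_avg f \<eta> z n + b *\<^sub>R pos n"
    by (simp add: u_def weights)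
  have "f u \<le> (1 - b) * f (eg_avg f \<eta> z n) + b * f (pos n)"
    unfolding u using convex_onD[OF convex, of b] b by simp
  then have "gap u \<le> (1 - b) * gap (eg_avg f \<eta> z n) + b * gap (pos n)"
    by (simp add: algebra_simps)
  also have "\<dots> \<le> (1 - b) * (2 / 3 * gap z + (D - E) / (3 * T)) + b * gap z"
    using gap_avg_le[OF assms(4)] gap_pos_le[of n] b unfolding D_def E_def T_def
    by (intro add_mono mult_left_mono) auto
  finally have gap_u: "gap u \<le> \<dots>" .
  have "(norm (u - p))\<^sup>2 \<le> (1 - b) * A + b * E"
    unfolding u A_def E_def using convex_onD[OF convex_on_sq_dist, of b] b by simp
  also have "\<dots> \<le> (1 - b) * (D + T / 3 * gap z) + b * E"
    using sq_dist_avg_le[OF assms(4)] b unfolding A_def D_def T_def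
    by (intro add_mono mult_left_mono) auto
  finally have "c * (norm (u - p))\<^sup>2 \<le> c * \<dots>"
    using c by (rule mult_left_mono)
  with gap_u have "gap u + c * (norm (u - p))\<^sup>2
      \<le> (1 - b) * (2 / 3 * gap z + (D - E) / (3 * T)) + b * gap z
        + c * ((1 - b) * (D + T / 3 * gap z) + b * E)" by linarith
  also have "\<dots> = ((1 - b) * 2 / 3 + b + (1 - b) * (c * T) / 3) * gap z
      + (1 - b) * (1 / (3 * T) + c) * D + (c * b - (1 - b) / (3 * T)) * E"
    by (simp add: algebra_simps add_divide_distrib diff_divide_distrib)
  also have "c * b - (1 - b) / (3 * T) = 0"
    using s2 T by (simp add: b_def c_def field_simps)
  also have "(1 - b) * (1 / (3 * T) + c) = c"
    using s2 T by (simp add: b_def c_def field_simps)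
  also have "(1 - b) * 2 / 3 + b + (1 - b) * (c * T) / 3 = (12 + 7 * s) / 27"
    using s2 T by (simp add: b_def c_def field_simps)
  also have "(12 + 7 * s) / 27 * gap z + c * D + 0 * E \<le> (s + 1) / 3 * gap z + c * D"
  proof -
    have "(12 + 7 * s) / 27 \<le> (s + 1) / 3" using s1 by simp
    then have "(12 + 7 * s) / 27 * gap z \<le> (s + 1) / 3 * gap z"
      using minimum[of z] by (intro mult_right_mono) auto
    then show ?thesis by simp
  qed
  finally show ?thesis by (simp add: c_def D_def s_def)
qed

end

end

theorem theorem4:
  fixes f :: "real ^ 'd \<Rightarrow> real"
    and xstar x0 :: "real ^ 'd"
    and L \<eta> :: real
    and K :: nat
    and N :: "nat \<Rightarrow> nat"
  assumes "\<forall>x. f differentiable (at x)"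
    and "\<forall>x. f xstar \<le> f x"
    and "\<forall>z. (\<forall>x. f z \<le> f x) \<longrightarrow> z = xstar"
    and "convex_on UNIV f"
    and "L > 0"
    and "L_smooth L f"
    and "0 < \<eta>"
    and "\<eta> \<le> 1 / sqrt L"
    and "K \<ge> 1"
    and "N 0 = 4"
    and "\<forall>k\<in>{1..K}. N k > 0"
    and "\<forall>k\<in>{1..K}. real (N k) * (real (N k) + 1)
           \<ge> 3 / (sqrt 3 + 1) * (real (N (k - 1)) * (real (N (k - 1)) + 1))"
  shows "f (dHFA_eg f ((sqrt 3 + 1) / 2) \<eta> N x0 K) - f xstar
    \<le> ((sqrt 3 + 1) / 3) ^ K *
        (f x0 - f xstar + (sqrt 3 - 1) / (60 * \<eta>\<^sup>2) * (norm (x0 - xstar))\<^sup>2)"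
proof -
  have "L \<le> 1 / \<eta>\<^sup>2"
  proof -
    have "\<eta>\<^sup>2 \<le> (1 / sqrt L)\<^sup>2" using assms(7,8) by (intro power_mono) auto
    also have "\<dots> = 1 / L" using assms(5) by (simp add: power_divide)
    finally show ?thesis using assms(5,7) by (simp add: field_simps)
  qed
  then interpret smooth_convex_min f \<eta> xstar
    using assms(1,2,4,6,7) by unfold_locales (auto intro: GDERIV_grad L_smooth_mono)
  define x where "x = dHFA_eg f ((sqrt 3 + 1) / 2) \<eta> N x0"
  define T where "T k = \<eta>\<^sup>2 * (real (N k) * (real (N k) + 1))" for k
  define \<rho> where "\<rho> = (sqrt 3 + 1) / (3::real)"
  define \<gamma> where "\<gamma> = (sqrt 3 - 1) / (3::real)"
  have \<rho>: "0 < \<rho>" by (simp add: \<rho>_def add_pos_pos)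
  have \<gamma>: "0 \<le> \<gamma>" by (simp add: \<gamma>_def)
  have N_pos: "N k > 0" if "k \<le> K" for k
    using that assms(10,11) by (cases k) auto
  have T_pos: "T k > 0" if "k \<le> K" for k
    using N_pos[OF that] assms(7) by (simp add: T_def)
  have T_growth: "\<gamma> / T (Suc k) \<le> \<rho> * (\<gamma> / T k)" if "Suc k \<le> K" for k
  proof -
    have "3 / (sqrt 3 + 1) * (real (N k) * (real (N k) + 1))
        \<le> real (N (Suc k)) * (real (N (Suc k)) + 1)"
      using assms(12) that by (metis One_nat_def Suc_le_mono atLeastAtMost_iff diff_Suc_1 zero_le)
    then have "\<eta>\<^sup>2 * (1 / \<rho> * (real (N k) * (real (N k) + 1))) \<le> T (Suc k)"
      unfolding T_def by (intro mult_left_mono) (simp_all add: \<rho>_def)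
    then have "T k / \<rho> \<le> T (Suc k)" by (simp add: T_def)
    then have "\<gamma> / T (Suc k) \<le> \<gamma> / (T k / \<rho>)"
      using \<gamma> \<rho> T_pos[of k] T_pos[of "Suc k"] that by (intro divide_left_mono mult_pos_pos) auto
    then show ?thesis by (simp add: mult.commute)
  qed
  \<comment> \<open>The potential uses the time scale of the finished iteration. The growth of the scales lets the
    potential of step \<open>k\<close> bound the distance term at scale \<open>k + 1\<close>; for \<open>k = 0\<close> the fictitious
    \<open>N 0 = 4\<close> gives \<open>T 0 = 20 \<eta>\<^sup>2\<close>.\<close>
  have "k \<le> K \<Longrightarrow> gap (x k) + \<gamma> / T k * (norm (x k - xstar))\<^sup>2
      \<le> \<rho> ^ k * (gap x0 + \<gamma> / T 0 * (norm (x0 - xstar))\<^sup>2)" for k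
  proof (induction k)
    case 0
    show ?case by (simp add: x_def)
  next
    case (Suc k)
    have "gap (x (Suc k)) + \<gamma> / T (Suc k) * (norm (x (Suc k) - xstar))\<^sup>2
        \<le> \<rho> * gap (x k) + \<gamma> / T (Suc k) * (norm (x k - xstar))\<^sup>2"
      using outer_step[of "N (Suc k)" "x k"] N_pos[OF Suc.prems]
      by (simp add: x_def T_def \<rho>_def \<gamma>_def Let_def)
    also have "\<dots> \<le> \<rho> * gap (x k) + \<rho> * (\<gamma> / T k) * (norm (x k - xstar))\<^sup>2"
      by (intro add_left_mono mult_right_mono T_growth[OF Suc.prems]) simp
    also have "\<dots> = \<rho> * (gap (x k) + \<gamma> / T k * (norm (x k - xstar))\<^sup>2)"
      by (simp add: algebra_simps)
    also have "\<dots> \<le> \<rho> * (\<rho> ^ k * (gap x0 + \<gamma> / T 0 * (norm (x0 - xstar))\<^sup>2))"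
      using Suc \<rho> by (intro mult_left_mono) auto
    finally show ?case by (simp add: mult.assoc)
  qed
  from this[of K] have "gap (x K) + \<gamma> / T K * (norm (x K - xstar))\<^sup>2
      \<le> \<rho> ^ K * (gap x0 + \<gamma> / T 0 * (norm (x0 - xstar))\<^sup>2)" by simp
  moreover have "0 \<le> \<gamma> / T K * (norm (x K - xstar))\<^sup>2"
    using \<gamma> T_pos[of K] by simp
  moreover have "\<gamma> / T 0 = (sqrt 3 - 1) / (60 * \<eta>\<^sup>2)"
    using assms(10) by (simp add: \<gamma>_def T_def)
  ultimately show ?thesis by (simp add: x_def \<rho>_def)
qed

end
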